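(* Let $D$ be a set, $k$ a positive integer, and $X\subseteq D^k$ a finite symmetric subset. Let $d$ be a positive integer and let $\overline{\mathcal{M}}_d(X)$ be the set of $k$-multisets in $\mathcal{M}(X)$ that have exactly $d$ distinct elements. Then $$|\overline{\mathcal{M}}_d(X)|=\frac{1}{k!}\sum_{\tau\in S_k}\overline{w}_d(\tau)\,|X_\tau|.$$
   Context: $D^k$ is the Cartesian product of $k$ copies of $D$. A subset $X\subseteq D^k$ is symmetric if $(x_{\tau(1)},\dots,x_{\tau(k)})\in X$ whenever $(x_1,\dots,x_k)\in X$ and $\tau\in S_k$. $\mathcal{M}(X)=\{[x_1,\dots,x_k]:(x_1,\dots,x_k)\in X\}$ is the set of $k$-multisets whose underlying ordered tuples lie in $X$. For $\tau\in S_k$, $X_\tau$ is the set of $(x_1,\dots,x_k)\in X$ such that $x_i$ is constant on each cycle of $\tau$. If $\tau$ has disjoint cycle decomposition with cycle lengths $\ell_1,\dots,\ell_{c(\tau)}$ (fixed points counted as cycles of length 1), then $\overline{w}_d(\tau)=[x^d]\prod_{i=1}^{c(\tau)}\bigl(1-(1-x)^{\ell_i}\bigr)$, where $[x^d]F(x)$ denotes the coefficient of $x^d$ in the polynomial $F(x)$. *)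

theory Defs
  imports
    Complex_Main
    "HOL-Library.NList"
    "HOL-Library.Multiset"
    "HOL-Combinatorics.Permutations"
    "HOL-Combinatorics.Orbits"
    "HOL-Computational_Algebra.Polynomial"
begin

text \<open>
  Elements of \<open>D\<^sup>k\<close> are lists in \<^term>\<open>nlists k D\<close>, with positions
  numbered from 0; accordingly \<open>S\<^sub>k\<close> is the set of permutations of \<^term>\<open>{..<k}\<close>.
\<close>

definition symmetric_tuples :: "nat \<Rightarrow> 'a list set \<Rightarrow> bool" where
  "symmetric_tuples k X \<longleftrightarrow>
     (\<forall>xs\<in>X. \<forall>\<tau>. \<tau> permutes {..<k} \<longrightarrow> permute_list \<tau> xs \<in> X)"

definition multisets_of :: "'a list set \<Rightarrow> 'a multiset set" where
  "multisets_of X = mset ` X"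

definition multisets_distinct :: "nat \<Rightarrow> 'a list set \<Rightarrow> 'a multiset set" where
  "multisets_distinct d X = {M \<in> multisets_of X. card (set_mset M) = d}"

text \<open>
  A cycle is represented by its underlying set of positions, i.e. an orbit;
  a fixed point \<open>i\<close> contributes the cycle \<open>{i}\<close> of length 1.
\<close>

definition perm_cycles :: "nat \<Rightarrow> (nat \<Rightarrow> nat) \<Rightarrow> nat set set" where
  "perm_cycles k \<tau> = orbit \<tau> ` {..<k}"

definition tuples_const_on_cycles ::
    "nat \<Rightarrow> 'a list set \<Rightarrow> (nat \<Rightarrow> nat) \<Rightarrow> 'a list set" where
  "tuples_const_on_cycles k X \<tau> =
     {xs \<in> X. \<forall>C\<in>perm_cycles k \<tau>. \<forall>i\<in>C. \<forall>j\<in>C. xs ! i = xs ! j}"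

text \<open>The polynomial \<^term>\<open>[:1, -1:] :: int poly\<close> is \<open>1 - x\<close>.\<close>

definition w_bar :: "nat \<Rightarrow> nat \<Rightarrow> (nat \<Rightarrow> nat) \<Rightarrow> int" where
  "w_bar k d \<tau> = coeff (\<Prod>C\<in>perm_cycles k \<tau>. 1 - [:1, -1:] ^ card C) d"

end

theory Submission
  imports Defs "HOL-Combinatorics.Multiset_Permutations"
begin

text \<open>
  Exchanging summations, the right-hand side becomes a sum over \<open>xs \<in> X\<close> of the weights of the
  permutations stabilising \<open>xs\<close>. Give the positions independent variables \<open>y\<^sub>i\<close> and weigh a
  cycle \<open>C\<close> by \<open>1 - (\<Prod>i\<in>C. y\<^sub>i)\<close>. Inserting a new position \<open>a\<close> in front of \<open>b\<close> in
  the cycle of \<open>b\<close> has the same effect on the weight as replacing \<open>y\<^sub>b\<close> by \<open>y\<^sub>a y\<^sub>b\<close>, so the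
  total weight of the stabiliser can be computed by induction on the number of positions; every
  level set \<open>L\<close> of \<open>xs\<close> contributes the factor \<open>|L|! - (|L| - 1)! (\<Sum>i\<in>L. y\<^sub>i)\<close>.
  For \<open>y\<^sub>i = 1 - x\<close> this factor is \<open>|L|! x\<close>, so the coefficient of \<open>x\<^sup>d\<close> is nonzero exactly
  when \<open>xs\<close> has \<open>d\<close> distinct entries, and then it is the order of the stabiliser.
  Finally, the orbit of \<open>xs\<close> consists of the orderings of its multiset.
\<close>

section \<open>Cycles after insertion of a new point\<close>

lemma orbit_subset_closed:
  assumes "x \<in> S" "\<And>z. z \<in> S \<Longrightarrow> f z \<in> S"
  shows "orbit f x \<subseteq> S"
proof
  fix z assume "z \<in> orbit f x"
  then show "z \<in> S" by induct (use assms in auto)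
qed

lemma permutation_orbit_eq:
  assumes "permutation f" "z \<in> orbit f x"
  shows "orbit f z = orbit f x"
  using cyclic_on_orbit'[OF assms(1), of x] assms(2) by (auto simp: cyclic_on_alldef)

lemma orbits_fixed_point_insert:
  assumes "q permutes A" "a \<notin> A"
  shows "orbit q ` insert a A = insert {a} (orbit q ` A)"
proof -
  have "q a = a" using assms by (simp add: permutes_not_in)
  then have "orbit q a \<subseteq> {a}" by (intro orbit_subset_closed) auto
  then have "orbit q a = {a}" using orbit_nonempty[of q a] by blast
  then show ?thesis by simp
qed

context
  fixes A :: "'a set" and a b :: 'a and q p :: "'a \<Rightarrow> 'a"
  assumes fin: "finite A" and a: "a \<notin> A" and b: "b \<in> A" and q: "q permutes A"
  defines "p \<equiv> transpose a b \<circ> q"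
begin

private lemma perms: "permutation q" "permutation p"
proof -
  show "permutation q" using fin q permutation_permutes by blast
  moreover have "permutation (transpose a b)" by (rule permutation_swap_id)
  ultimately show "permutation p" unfolding p_def by (intro permutation_compose)
qed

private lemma q_a: "q a = a"
  using a q by (simp add: permutes_not_in)

private lemma q_ne_a: "q z \<noteq> a" if "z \<noteq> a"
  using that q_a permutes_inj[OF q] by (metis injD)

text \<open>Composing with the transposition splices \<open>a\<close> into the cycle of
  \<open>b\<close>: the \<open>q\<close>-predecessor of \<open>b\<close> now goes to
  \<open>a\<close>, and \<open>a\<close> goes on to \<open>b\<close>.\<close>

private lemma p_apply: "p z = (if z = a then b else if q z = b then a else q z)"
  using q_ne_a q_a by (auto simp: p_def transpose_def)

lemma orbit_transpose_comp_new: "orbit p a = insert a (orbit q b)"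
proof
  have "b \<in> orbit q b" using perms by (simp add: permutation_self_in_orbit)
  then show "orbit p a \<subseteq> insert a (orbit q b)"
    by (intro orbit_subset_closed) (auto simp: p_apply intro: orbit.step)
  have pa: "a \<in> orbit p a" using perms by (simp add: permutation_self_in_orbit)
  have pb: "b \<in> orbit p a" using orbit.base[of p a] by (simp add: p_apply)
  \<comment> \<open>Without \<open>a\<close> the set is closed under \<open>q\<close>: where
    \<open>p\<close> detours through \<open>a\<close>, the value \<open>q z\<close> is
    \<open>b\<close>, which is already in the set; elsewhere \<open>q z = p z\<close>.\<close>
  have "orbit q b \<subseteq> orbit p a - {a}"
  proof (rule orbit_subset_closed)
    show "b \<in> orbit p a - {a}" using pb a b by auto
    fix z assume "z \<in> orbit p a - {a}"
    then show "q z \<in> orbit p a - {a}"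
      using orbit.step[of z p a] pb q_ne_a[of z] by (auto simp: p_apply split: if_splits)
  qed
  then show "insert a (orbit q b) \<subseteq> orbit p a" using pa by auto
qed

text \<open>Within \<open>A\<close>, \<open>p\<close> and \<open>q\<close> differ only at the
  \<open>q\<close>-predecessor of \<open>b\<close>, which lies on the cycle of
  \<open>b\<close>.\<close>

lemma orbit_transpose_comp_old:
  assumes "x \<in> A" "x \<notin> orbit q b"
  shows "orbit p x = orbit q x"
proof (rule orbit_cong)
  show "x \<in> orbit q x" using perms by (simp add: permutation_self_in_orbit)
  fix z assume z: "z \<in> orbit q x"
  then have "q z \<in> orbit q x" by (rule orbit.step)
  moreover have "b \<notin> orbit q x"
    using assms(2) perms permutation_orbit_eq permutation_self_in_orbit by metis
  moreover have "z \<in> A" using z permutes_orbit_subset[OF q assms(1)] by blast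
  ultimately show "p z = q z" using a by (auto simp: p_apply)
qed

lemma orbits_transpose_comp:
  "orbit p ` insert a A = insert (insert a (orbit q b)) (orbit q ` (A - orbit q b))"
proof -
  have "orbit p x = orbit p a" if "x \<in> orbit q b" for x
    using that perms by (intro permutation_orbit_eq) (auto simp: orbit_transpose_comp_new)
  then have "orbit p ` insert a A = insert (orbit p a) (orbit p ` (A - orbit q b))"
    by blast
  also have "orbit p ` (A - orbit q b) = orbit q ` (A - orbit q b)"
    by (intro image_cong) (auto simp: orbit_transpose_comp_old)
  finally show ?thesis by (simp add: orbit_transpose_comp_new)
qed

lemma orbits_split: "orbit q ` A = insert (orbit q b) (orbit q ` (A - orbit q b))"
proof -
  have "orbit q x = orbit q b" if "x \<in> orbit q b" for x
    using that perms by (intro permutation_orbit_eq)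
  then show ?thesis using b by blast
qed

text \<open>Only the cycle of \<open>b\<close> changes; its new factor \<open>y a\<close> is
  absorbed into the value at \<open>b\<close>. The other cycles avoid \<open>b\<close> and do not
  see the update.\<close>

lemma prod_orbits_transpose_comp:
  fixes y :: "'a \<Rightarrow> 'b::comm_ring_1"
  shows "(\<Prod>C\<in>orbit p ` insert a A. 1 - (\<Prod>i\<in>C. y i)) =
    (\<Prod>C\<in>orbit q ` A. 1 - (\<Prod>i\<in>C. (y(b := y a * y b)) i))"
proof -
  let ?O = "orbit q b" and ?R = "orbit q ` (A - orbit q b)"
  let ?y = "y(b := y a * y b)"
  have bO: "b \<in> ?O" using perms by (simp add: permutation_self_in_orbit)
  have OA: "?O \<subseteq> A" using permutes_orbit_subset[OF q b] .
  then have finO: "finite ?O" using fin finite_subset by blast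
  have RA: "C \<subseteq> A" if "C \<in> ?R" for C using that permutes_orbit_subset[OF q] by blast
  have bR: "b \<notin> C" if "C \<in> ?R" for C
    using that perms permutation_orbit_eq permutation_self_in_orbit by (metis DiffE imageE)
  have "(\<Prod>i\<in>insert a ?O. y i) = y a * (y b * (\<Prod>i\<in>?O - {b}. y i))"
    using finO OA a bO by (subst prod.insert) (auto simp: prod.remove[of ?O b])
  also have "\<dots> = (\<Prod>i\<in>?O. ?y i)"
    using finO bO by (simp add: prod.remove[of ?O b] mult.assoc)
  finally have O: "(\<Prod>i\<in>insert a ?O. y i) = (\<Prod>i\<in>?O. ?y i)" .
  have R: "(\<Prod>C\<in>?R. 1 - (\<Prod>i\<in>C. y i)) = (\<Prod>C\<in>?R. 1 - (\<Prod>i\<in>C. ?y i))"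
  proof (rule prod.cong[OF refl])
    fix C assume "C \<in> ?R"
    then have "(\<Prod>i\<in>C. y i) = (\<Prod>i\<in>C. ?y i)"
      using bR by (intro prod.cong) auto
    then show "1 - (\<Prod>i\<in>C. y i) = 1 - (\<Prod>i\<in>C. ?y i)" by simp
  qed
  \<comment> \<open>The products range over sets of cycles, so splitting off one factor requires
    that cycle to differ from the remaining ones.\<close>
  have "insert a ?O \<notin> ?R" "?O \<notin> ?R" using RA bR a bO by blast+
  then show ?thesis
    unfolding orbits_transpose_comp orbits_split using fin
    by (simp only: prod.insert finite_imageI finite_Diff O R not_False_eq_True)
qed

text \<open>Since \<open>p a = b\<close>, the condition at \<open>a\<close> is
  \<open>f b = f a\<close>; once this holds, sending a point to \<open>a\<close> instead of
  \<open>b\<close> is invisible to \<open>f\<close>.\<close>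

lemma transpose_comp_preserves_iff:
  "(\<forall>i\<in>insert a A. f (p i) = f i) \<longleftrightarrow> f b = f a \<and> (\<forall>i\<in>A. f (q i) = f i)"
proof
  assume pres: "\<forall>i\<in>insert a A. f (p i) = f i"
  then have ab: "f b = f a" by (simp add: p_apply)
  have "f (q i) = f i" if "i \<in> A" for i
  proof -
    have "f (p i) = f i" using pres that by simp
    moreover have "i \<noteq> a" using that a by blast
    ultimately show ?thesis using ab by (cases "q i = b") (simp_all add: p_apply)
  qed
  with ab show "f b = f a \<and> (\<forall>i\<in>A. f (q i) = f i)" by blast
next
  assume pres: "f b = f a \<and> (\<forall>i\<in>A. f (q i) = f i)"
  have "f (p i) = f i" if "i \<in> A" for i
  proof -
    have "f (q i) = f i" using pres that by simp
    moreover have "i \<noteq> a" using that a by blast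
    ultimately show ?thesis using pres by (cases "q i = b") (simp_all add: p_apply)
  qed
  with pres show "\<forall>i\<in>insert a A. f (p i) = f i" by (simp add: p_apply)
qed

end

section \<open>Total cycle weight of a stabiliser\<close>

definition stabilizer_weight ::
    "'a set \<Rightarrow> ('a \<Rightarrow> 'c) \<Rightarrow> ('a \<Rightarrow> 'b::comm_ring_1) \<Rightarrow> 'b" where
  "stabilizer_weight A f y =
     (\<Sum>p | p permutes A \<and> (\<forall>i\<in>A. f (p i) = f i). \<Prod>C\<in>orbit p ` A. 1 - (\<Prod>i\<in>C. y i))"

text \<open>Each permutation of \<open>insert a A\<close> is uniquely
  \<open>transpose a b \<circ> q\<close> with \<open>q\<close> permuting \<open>A\<close>. For
  \<open>b = a\<close> the point \<open>a\<close> is a fixed cycle of weight \<open>1 - y a\<close>;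
  for \<open>b\<close> in \<open>A\<close> it is spliced into the cycle of \<open>b\<close>.\<close>

lemma stabilizer_weight_insert:
  fixes y :: "'a \<Rightarrow> 'b::comm_ring_1"
  assumes fin: "finite A" and a: "a \<notin> A"
  shows "stabilizer_weight (insert a A) f y = (1 - y a) * stabilizer_weight A f y +
    (\<Sum>b | b \<in> A \<and> f b = f a. stabilizer_weight A f (y(b := y a * y b)))"
proof -
  define P where "P S p \<longleftrightarrow> (\<forall>i\<in>S. f (p i) = f i)" for S and p :: "'a \<Rightarrow> 'a"
  define w where "w S y p = (\<Prod>C\<in>orbit p ` S. 1 - (\<Prod>i\<in>C. y i))"
    for S p and y :: "'a \<Rightarrow> 'b"
  \<comment> \<open>The stabiliser condition moves into the summand, because
    \<open>sum_over_permutations_insert\<close> speaks of all permutations.\<close>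
  have sw: "stabilizer_weight S f y = (\<Sum>p | p permutes S. if P S p then w S y p else 0)"
    if "finite S" for S and y :: "'a \<Rightarrow> 'b"
    unfolding stabilizer_weight_def
    using sum.inter_filter[OF finite_permutations[OF that], of "w S y" "P S"]
    by (simp add: P_def w_def)
  let ?t = "\<lambda>b. \<Sum>q | q permutes A. if P (insert a A) (transpose a b \<circ> q)
      then w (insert a A) y (transpose a b \<circ> q) else 0"
  have "stabilizer_weight (insert a A) f y = (\<Sum>b\<in>insert a A. ?t b)"
    using fin a by (simp add: sw sum_over_permutations_insert)
  also have "\<dots> = ?t a + (\<Sum>b\<in>A. ?t b)"
    using fin a by simp
  also have "?t a = (\<Sum>q | q permutes A. (1 - y a) * (if P A q then w A y q else 0))"
  proof (rule sum.cong[OF refl])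
    fix q assume "q \<in> {q. q permutes A}"
    then have q: "q permutes A" by simp
    have qa: "q a = a" using a q by (simp add: permutes_not_in)
    have "{a} \<notin> orbit q ` A" using permutes_orbit_subset[OF q] a by blast
    then have "w (insert a A) y q = (1 - y a) * w A y q"
      unfolding w_def orbits_fixed_point_insert[OF q a] using fin by simp
    moreover have "P (insert a A) q = P A q" using qa by (simp add: P_def)
    ultimately show "(if P (insert a A) (transpose a a \<circ> q)
        then w (insert a A) y (transpose a a \<circ> q) else 0) =
      (1 - y a) * (if P A q then w A y q else 0)" by simp
  qed
  also have "\<dots> = (1 - y a) * stabilizer_weight A f y"
    using fin by (simp add: sw sum_distrib_left)
  also have "(\<Sum>b\<in>A. ?t b) =
      (\<Sum>b\<in>A. if f b = f a then stabilizer_weight A f (y(b := y a * y b)) else 0)"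
  proof (rule sum.cong[OF refl])
    fix b assume b: "b \<in> A"
    have "?t b = (\<Sum>q | q permutes A.
        if f b = f a \<and> P A q then w A (y(b := y a * y b)) q else 0)"
      unfolding P_def w_def
      by (intro sum.cong refl if_cong transpose_comp_preserves_iff prod_orbits_transpose_comp)
        (use fin a b in auto)
    then show "?t b = (if f b = f a then stabilizer_weight A f (y(b := y a * y b)) else 0)"
      using fin by (simp add: sw)
  qed
  also have "\<dots> = (\<Sum>b | b \<in> A \<and> f b = f a. stabilizer_weight A f (y(b := y a * y b)))"
    by (rule sum.inter_filter[OF fin, symmetric])
  finally show ?thesis .
qed

text \<open>The induction keeps \<open>y\<close> arbitrary, as the recursion alters it at
  \<open>b\<close>. Adding \<open>a\<close> affects only the factor of the level set of
  \<open>f a\<close>.\<close>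

lemma stabilizer_weight_eq:
  fixes y :: "'a \<Rightarrow> 'b::{comm_ring_1,semiring_char_0}"
  assumes "finite A"
  shows "stabilizer_weight A f y = (\<Prod>v\<in>f ` A. fact (card {i\<in>A. f i = v}) -
    fact (card {i\<in>A. f i = v} - 1) * (\<Sum>i | i \<in> A \<and> f i = v. y i))"
  using assms
proof (induction A arbitrary: y rule: finite_induct)
  case empty
  have "{p. p permutes ({}::'a set)} = {id}" by auto
  then show ?case by (simp add: stabilizer_weight_def)
next
  case (insert a A)
  define L where "L S v = {i\<in>S. f i = v}" for S v
  define h where "h S y v = fact (card (L S v)) - fact (card (L S v) - 1) * (\<Sum>i\<in>L S v. y i)"
    for S v and y :: "'a \<Rightarrow> 'b"
  have IH: "stabilizer_weight A f y = (\<Prod>v\<in>f ` A. h A y v)" for y :: "'a \<Rightarrow> 'b"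
    using insert.IH[of y] by (simp add: h_def L_def)
  let ?v = "f a" and ?n = "card (L A (f a))" and ?s = "\<Sum>i\<in>L A (f a). y i"
  have finL: "finite (L A v)" for v using insert.hyps by (simp add: L_def)
  have aL: "a \<notin> L A v" for v using insert.hyps by (simp add: L_def)
  have L_insert: "L (insert a A) v = (if v = ?v then insert a (L A v) else L A v)" for v
    by (auto simp: L_def)
  have other: "h (insert a A) y v = h A y v" if "v \<noteq> ?v" for v
    using that by (simp add: h_def L_insert)
  have new: "h (insert a A) y ?v = fact (Suc ?n) - fact ?n * (y a + ?s)"
    using finL aL by (simp add: h_def L_insert)
  let ?R = "\<Prod>v\<in>f ` A - {?v}. h A y v"
  have "(\<Prod>v\<in>f ` insert a A. h (insert a A) y v) =
      h (insert a A) y ?v * (\<Prod>v\<in>f ` A - {?v}. h (insert a A) y v)"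
    using insert.hyps by (simp add: prod.insert_remove)
  also have "(\<Prod>v\<in>f ` A - {?v}. h (insert a A) y v) = ?R"
    by (intro prod.cong) (auto simp: other)
  finally have goal: "(\<Prod>v\<in>f ` insert a A. h (insert a A) y v) =
      (fact (Suc ?n) - fact ?n * (y a + ?s)) * ?R"
    by (simp only: new)
  have "stabilizer_weight (insert a A) f y = (1 - y a) * stabilizer_weight A f y +
    (\<Sum>b\<in>L A ?v. stabilizer_weight A f (y(b := y a * y b)))"
    using stabilizer_weight_insert[OF insert.hyps] by (simp add: L_def)
  also have "\<dots> = (fact (Suc ?n) - fact ?n * (y a + ?s)) * ?R"
  \<comment> \<open>If \<open>f a\<close> is a new value, there is no \<open>b\<close> to sum over
    and the new factor is just \<open>1 - y a\<close>. Otherwise the level set has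
    \<open>Suc m\<close> elements, so the subtraction in \<open>card - 1\<close> is not
    truncated.\<close>
  proof (cases "L A ?v = {}")
    case True
    then have "?v \<notin> f ` A" by (auto simp: L_def)
    then have "f ` A - {?v} = f ` A" by auto
    then show ?thesis using True by (simp add: IH)
  next
    case False
    then have vA: "?v \<in> f ` A" by (auto simp: L_def intro: rev_image_eqI)
    from False finL obtain m where m: "?n = Suc m"
      by (metis card_gt_0_iff gr0_implies_Suc)
    have split: "stabilizer_weight A f z = h A z ?v * (\<Prod>v\<in>f ` A - {?v}. h A z v)"
      for z :: "'a \<Rightarrow> 'b"
      using insert.hyps vA by (simp add: IH prod.remove[of "f ` A" ?v])
    \<comment> \<open>The update at \<open>b\<close> shifts the sum over this level set by
      \<open>y a * y b - y b\<close> and leaves the other level sets alone.\<close>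
    have step: "stabilizer_weight A f (y(b := y a * y b)) =
        (fact (Suc m) - fact m * (?s + (y a * y b - y b))) * ?R" if b: "b \<in> L A ?v" for b
    proof -
      have "(\<Sum>i\<in>L A ?v. (y(b := y a * y b)) i) = ?s + (y a * y b - y b)"
        using finL b by (simp add: sum.remove[of _ b])
      moreover have "h A (y(b := y a * y b)) v = h A y v" if "v \<noteq> ?v" for v
      proof -
        have "(\<Sum>i\<in>L A v. (y(b := y a * y b)) i) = (\<Sum>i\<in>L A v. y i)"
          using that b by (intro sum.cong) (auto simp: L_def)
        then show ?thesis by (simp add: h_def)
      qed
      ultimately show ?thesis
        unfolding split by (simp add: h_def m)
    qed
    have "(\<Sum>b\<in>L A ?v. fact (Suc m) - fact m * (?s + (y a * y b - y b))) =
        of_nat (Suc m) * (fact (Suc m) - fact m * ?s) - fact m * (y a * ?s - ?s)"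
      by (simp add: sum_subtractf sum.distrib sum_distrib_left distrib_left right_diff_distrib m
          algebra_simps)
    moreover have "(\<Sum>b\<in>L A ?v. stabilizer_weight A f (y(b := y a * y b))) =
        (\<Sum>b\<in>L A ?v. fact (Suc m) - fact m * (?s + (y a * y b - y b))) * ?R"
      unfolding sum_distrib_right by (intro sum.cong) (simp_all only: step)
    moreover have "stabilizer_weight A f y = (fact (Suc m) - fact m * ?s) * ?R"
      unfolding split by (simp add: h_def m)
    \<comment> \<open>The recursion as a ring identity: \<open>M\<close> is the size of the level
      set, \<open>F\<close> is (M - 1)!, \<open>s\<close> is its sum of \<open>y\<close>, and
      \<open>R\<close> collects the other factors. The terms in \<open>ya * s\<close> cancel, so the
      factor stays linear in \<open>y\<close>.\<close>
    moreover have "(1 - ya) * ((M * F - F * s) * R) +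
        (M * (M * F - F * s) - F * (ya * s - s)) * R =
      ((M + 1) * (M * F) - M * F * (ya + s)) * R" for ya M F s R :: 'b
      by (simp add: algebra_simps)
    from this[of "y a" "of_nat (Suc m)" "fact m" ?s ?R]
    have "(1 - y a) * ((fact (Suc m) - fact m * ?s) * ?R) +
        (of_nat (Suc m) * (fact (Suc m) - fact m * ?s) - fact m * (y a * ?s - ?s)) * ?R =
      (fact (Suc (Suc m)) - fact (Suc m) * (y a + ?s)) * ?R"
      by (simp only: fact_Suc of_nat_mult of_nat_Suc add.commute[of 1])
    ultimately show ?thesis by (simp only: m)
  qed
  finally show ?case
    using goal by (simp add: h_def L_def)
qed

section \<open>Specialisation to tuples and to \<open>w_bar\<close>\<close>

text \<open>Equality along single steps of a cycle propagates around it. This turns the defining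
  condition of \<open>tuples_const_on_cycles\<close> into the one in
  \<open>stabilizer_weight\<close> with \<open>f = (!) xs\<close>.\<close>

lemma const_on_cycles_iff:
  assumes "\<tau> permutes {..<k}"
  shows "(\<forall>C\<in>perm_cycles k \<tau>. \<forall>i\<in>C. \<forall>j\<in>C. xs ! i = xs ! j) \<longleftrightarrow>
    (\<forall>i\<in>{..<k}. xs ! \<tau> i = xs ! i)" (is "?L \<longleftrightarrow> ?R")
proof
  have perm: "permutation \<tau>" using assms permutation_permutes by blast
  show ?R if ?L
    using that permutation_self_in_orbit[OF perm] orbit.base[of \<tau>]
    unfolding perm_cycles_def by blast
  assume R: ?R
  have "xs ! z = xs ! i" if "i < k" "z \<in> orbit \<tau> i" for i z
    using that(2)
  proof induct
    case base
    then show ?case using R that by auto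
  next
    case (step z)
    then have "z < k" using permutes_orbit_subset[OF assms, of i] that by auto
    then show ?case using R step by auto
  qed
  then show ?L unfolding perm_cycles_def by (metis imageE lessThan_iff)
qed

lemma card_positions_eq_count: "card {i\<in>{..<length xs}. xs ! i = v} = count (mset xs) v"
proof -
  have "count (mset xs) v = length (filter (\<lambda>u. u = v) xs)"
    by (induction xs) auto
  then show ?thesis by (simp add: length_filter_conv_card)
qed

lemma sum_w_bar_stabilizer:
  "(\<Sum>\<tau> | \<tau> permutes {..<length xs} \<and> (\<forall>i\<in>{..<length xs}. xs ! \<tau> i = xs ! i).
      w_bar (length xs) d \<tau>) =
    (if card (set xs) = d then \<Prod>v\<in>set xs. fact (count (mset xs) v) else 0)"
proof -
  let ?A = "{..<length xs}"
  let ?c = "\<lambda>v. count (mset xs) v"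
  have "(\<Sum>\<tau> | \<tau> permutes ?A \<and> (\<forall>i\<in>?A. xs ! \<tau> i = xs ! i). w_bar (length xs) d \<tau>) =
      coeff (stabilizer_weight ?A ((!) xs) (\<lambda>_. [:1, -1:])) d"
    unfolding stabilizer_weight_def w_bar_def perm_cycles_def
    by (simp add: coeff_sum)
  also have "stabilizer_weight ?A ((!) xs) (\<lambda>_. [:1, -1:] :: int poly) =
      (\<Prod>v\<in>set xs. fact (?c v) - fact (?c v - 1) * (of_nat (?c v) * [:1, -1:]))"
  proof -
    have "(!) xs ` ?A = set xs" by (auto simp: set_conv_nth)
    then show ?thesis
      using card_positions_eq_count[of xs] by (simp add: stabilizer_weight_eq)
  qed
  also have "\<dots> = (\<Prod>v\<in>set xs. monom (fact (?c v)) 1)"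
  proof (rule prod.cong[OF refl])
    fix v assume "v \<in> set xs"
    \<comment> \<open>Positivity is essential: (c - 1)! * c = c! fails for c = 0 under truncated
      subtraction.\<close>
    then have "?c v > 0" by (rule count_mset_gt_0)
    then have "fact (?c v - 1) * of_nat (?c v) = (fact (?c v) :: int poly)"
      by (simp add: fact_reduce mult.commute)
    then have "fact (?c v) - fact (?c v - 1) * (of_nat (?c v) * [:1, -1:]) =
        fact (?c v) * (1 - [:1, -1:] :: int poly)"
      by (simp only: mult.assoc[symmetric] right_diff_distrib mult_1_right)
    also have "\<dots> = of_nat (fact (?c v)) * [:0, 1:]"
      by (simp add: one_pCons)
    also have "\<dots> = monom (fact (?c v)) 1"
      by (simp add: of_nat_poly monom_altdef)
    finally show "fact (?c v) - fact (?c v - 1) * (of_nat (?c v) * [:1, -1:]) =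
      (monom (fact (?c v)) 1 :: int poly)" .
  qed
  \<comment> \<open>Each distinct entry contributes one to the degree.\<close>
  also have "\<dots> = monom (\<Prod>v\<in>set xs. fact (?c v)) (card (set xs))"
    using finite_set[of xs] by (induction rule: finite_induct) (auto simp: mult_monom monom_0 one_pCons)
  finally show ?thesis by simp
qed

section \<open>Counting multisets through their orderings\<close>

text \<open>Lists with equal multisets differ by a permutation of positions. Hence the fibre of
  \<open>mset\<close> in \<open>X\<close> over any of its multisets consists of all orderings of
  that multiset.\<close>

lemma symmetric_tuples_mset_closed:
  assumes "symmetric_tuples k X" "X \<subseteq> nlists k D" "ys \<in> X" "mset xs = mset ys"
  shows "xs \<in> X"
proof -
  obtain p where "p permutes {..<length ys}" "permute_list p ys = xs"
    using mset_eq_permutation[OF assms(4)] by blast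
  moreover have "length ys = k" using assms by auto
  ultimately show ?thesis using assms unfolding symmetric_tuples_def by blast
qed

theorem theorem1p8:
  fixes D :: "'a set" and X :: "'a list set" and k d :: nat
  assumes "k > 0"
    and "d > 0"
    and "X \<subseteq> nlists k D"
    and "finite X"
    and "symmetric_tuples k X"
  shows "real (card (multisets_distinct d X)) =
    1 / fact k * (\<Sum>\<tau> | \<tau> permutes {..<k}.
      real_of_int (w_bar k d \<tau>) * real (card (tuples_const_on_cycles k X \<tau>)))"
proof -
  let ?P = "{\<tau>. \<tau> permutes {..<k}}"
  \<comment> \<open>The stabiliser weight of a tuple depends on its multiset alone, so it is
    constant on the fibres of \<open>mset\<close>.\<close>
  let ?g = "\<lambda>M. if card (set_mset M) = d then \<Prod>v\<in>set_mset M. fact (count M v) else 0 :: int"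
  let ?st = "\<lambda>xs \<tau>. \<forall>i\<in>{..<k}. xs ! \<tau> i = xs ! i"
  have finP: "finite ?P" by (simp add: finite_permutations)
  have len: "length xs = k" if "xs \<in> X" for xs using that assms(3) by auto
  have finM: "finite (multisets_of X)" using assms(4) by (simp add: multisets_of_def)
  have "(\<Sum>\<tau>\<in>?P. w_bar k d \<tau> * int (card (tuples_const_on_cycles k X \<tau>))) =
      (\<Sum>\<tau>\<in>?P. \<Sum>xs\<in>X. if ?st xs \<tau> then w_bar k d \<tau> else 0)"
  proof (rule sum.cong[OF refl])
    fix \<tau> assume "\<tau> \<in> ?P"
    then have "tuples_const_on_cycles k X \<tau> = {xs\<in>X. ?st xs \<tau>}"
      unfolding tuples_const_on_cycles_def using const_on_cycles_iff[of \<tau> k] by auto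
    then show "w_bar k d \<tau> * int (card (tuples_const_on_cycles k X \<tau>)) =
        (\<Sum>xs\<in>X. if ?st xs \<tau> then w_bar k d \<tau> else 0)"
      using sum.inter_filter[OF assms(4), of "\<lambda>_. w_bar k d \<tau>" "\<lambda>xs. ?st xs \<tau>"]
      by (simp add: mult.commute)
  qed
  also have "\<dots> = (\<Sum>xs\<in>X. \<Sum>\<tau>\<in>?P. if ?st xs \<tau> then w_bar k d \<tau> else 0)"
    by (rule sum.swap)
  also have "\<dots> = (\<Sum>xs\<in>X. ?g (mset xs))"
  proof (rule sum.cong[OF refl])
    fix xs assume "xs \<in> X"
    then have "(\<Sum>\<tau> | \<tau> permutes {..<k} \<and> ?st xs \<tau>. w_bar k d \<tau>) = ?g (mset xs)"
      using sum_w_bar_stabilizer[of xs d] len[of xs] by simp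
    moreover have "(\<Sum>\<tau> | \<tau> permutes {..<k} \<and> ?st xs \<tau>. w_bar k d \<tau>) =
        (\<Sum>\<tau>\<in>?P. if ?st xs \<tau> then w_bar k d \<tau> else 0)"
      using sum.inter_filter[OF finP, of "w_bar k d" "?st xs"] by simp
    ultimately show "(\<Sum>\<tau>\<in>?P. if ?st xs \<tau> then w_bar k d \<tau> else 0) = ?g (mset xs)"
      by (simp only:)
  qed
  also have "\<dots> = (\<Sum>M\<in>multisets_of X. \<Sum>xs | xs \<in> X \<and> mset xs = M. ?g (mset xs))"
    unfolding multisets_of_def using assms(4) by (rule sum.image_gen)
  also have "\<dots> = (\<Sum>M\<in>multisets_of X. if card (set_mset M) = d then fact k else 0)"
  proof (rule sum.cong[OF refl])
    fix M assume "M \<in> multisets_of X"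
    then obtain ys where ys: "ys \<in> X" "M = mset ys" by (auto simp: multisets_of_def)
    have "{xs \<in> X. mset xs = M} = permutations_of_multiset M"
      using symmetric_tuples_mset_closed[OF assms(5,3) ys(1)] ys
      by (auto simp: permutations_of_multiset_def)
    then have "(\<Sum>xs | xs \<in> X \<and> mset xs = M. ?g (mset xs)) =
        int (card (permutations_of_multiset M)) * ?g M"
      by (simp add: permutations_of_multiset_def)
    \<comment> \<open>Orbit-stabiliser: the number of orderings times the product of the factorials
      of the multiplicities is k!.\<close>
    moreover have "int (card (permutations_of_multiset M)) *
        (\<Prod>v\<in>set_mset M. fact (count M v)) = fact k"
    proof -
      have "size M = k" using ys len by simp
      then show ?thesis
        using arg_cong[OF card_permutations_of_multiset_aux[of M], of int] by simp
    qed
    ultimately show "(\<Sum>xs | xs \<in> X \<and> mset xs = M. ?g (mset xs)) =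
        (if card (set_mset M) = d then fact k else 0)" by simp
  qed
  also have "\<dots> = fact k * int (card (multisets_distinct d X))"
    using sum.inter_filter[OF finM, of "\<lambda>_. fact k :: int" "\<lambda>M. card (set_mset M) = d"]
    by (simp add: multisets_distinct_def mult.commute)
  finally have "real_of_int (\<Sum>\<tau>\<in>?P. w_bar k d \<tau> * int (card (tuples_const_on_cycles k X \<tau>))) =
      real_of_int (fact k * int (card (multisets_distinct d X)))"
    by simp
  then show ?thesis by simp
qed

end
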